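(* Let $d\geq 1$ and $n\geq 1$ be integers, let $\Omega\subset\mathbb{R}^d$ be compact, and let $\boldsymbol{\eta}=(\eta_1,\eta_2,\dots,\eta_m):\Omega^n\to\mathbb{R}^m$ satisfy the following three conditions: (i) $\eta_k:\Omega^n\to\mathbb{R}$ is anti-symmetric and continuous for each $k\in\{1,2,\dots,m\}$; (ii) for $\mathbf{x}_1,\dots,\mathbf{x}_n\in\Omega$, $\boldsymbol{\eta}(\mathbf{x}_1,\dots,\mathbf{x}_n)=0$ if and only if $\mathbf{x}_i=\mathbf{x}_j$ for some $i,j\in\{1,\dots,n\}$ with $i\neq j$; (iii) if $(\mathbf{x}_1,\dots,\mathbf{x}_n),(\mathbf{x}_1',\dots,\mathbf{x}_n')\in\Omega^n$ satisfy $\boldsymbol{\eta}(\mathbf{x}_1,\dots,\mathbf{x}_n)=\boldsymbol{\eta}(\mathbf{x}_1',\dots,\mathbf{x}_n')\neq 0$, then there exists a permutation $\sigma\in S_n$ such that $(\mathbf{x}_1',\dots,\mathbf{x}_n')=(\mathbf{x}_{\sigma(1)},\dots,\mathbf{x}_{\sigma(n)})$. Then for any anti-symmetric continuous function $f:\Omega^n\to\mathbb{R}$, there exists a unique $g:\boldsymbol{\eta}(\Omega^n)\to\mathbb{R}$ that is continuous and odd, and satisfies $$f(\mathbf{x}_1,\mathbf{x}_2,\dots,\mathbf{x}_n)=g\left(\boldsymbol{\eta}(\mathbf{x}_1,\mathbf{x}_2,\dots,\mathbf{x}_n)\right),\quad\forall\,\mathbf{x}_1,\mathbf{x}_2,\dots,\mathbf{x}_n\in\Omega,$$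 where $\boldsymbol{\eta}(\Omega^n)$ is equipped with the topology induced from $\mathbb{R}^m$.
   Context: $S_n$ is the group of all permutations of $\{1,2,\dots,n\}$ and $(-1)^\sigma$ is the signature of $\sigma\in S_n$. A function $f:\Omega^n\to\mathbb{R}$ is (totally) anti-symmetric if $f(\mathbf{x}_{\sigma(1)},\dots,\mathbf{x}_{\sigma(n)})=(-1)^\sigma f(\mathbf{x}_1,\dots,\mathbf{x}_n)$ for all $\sigma\in S_n$ and all $\mathbf{x}_1,\dots,\mathbf{x}_n\in\Omega$. The set $\boldsymbol{\eta}(\Omega^n)\subseteq\mathbb{R}^m$ is the image of $\boldsymbol{\eta}$, and $g$ is odd if $g(-\mathbf{y})=-g(\mathbf{y})$ for all $\mathbf{y}\in\boldsymbol{\eta}(\Omega^n)$.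
   Formalization: Oddness of g is claimed only for n ≥ 2; for n = 1 existence and uniqueness of a continuous g are kept without oddness, since oddness fails there (Ω = {−1, 1}, η(x) = x, f = 1 forces g = 1). *)

theory Defs
  imports "HOL-Analysis.Analysis" "HOL-Combinatorics.Permutations"
begin

text \<open>
  A point of \<open>\<Omega>\<^sup>n\<close> with \<open>\<Omega> \<subseteq> \<real>\<^sup>d\<close> is a vector of vectors in \<open>real ^ 'd ^ 'n\<close>, where
  \<open>n = CARD('n) \<ge> 1\<close> and \<open>d = CARD('d) \<ge> 1\<close>; its topology is the product topology.
  The group \<open>S\<^sub>n\<close> is the group of permutations of the index type \<open>'n\<close>.
\<close>

definition cart_power :: "'a set \<Rightarrow> ('a ^ 'n) set" where
  "cart_power \<Omega> = {x. \<forall>i. x $ i \<in> \<Omega>}"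

definition permute_vec :: "('n \<Rightarrow> 'n) \<Rightarrow> 'a ^ 'n \<Rightarrow> 'a ^ 'n" where
  "permute_vec \<sigma> x = (\<chi> i. x $ \<sigma> i)"

definition anti_symmetric_on :: "'a set \<Rightarrow> ('a ^ 'n::finite \<Rightarrow> real) \<Rightarrow> bool" where
  "anti_symmetric_on \<Omega> f \<longleftrightarrow>
    (\<forall>\<sigma>. \<sigma> permutes UNIV \<longrightarrow>
      (\<forall>x\<in>cart_power \<Omega>. f (permute_vec \<sigma> x) = of_int (sign \<sigma>) * f x))"

text \<open>
  The condition \<open>- y \<in> Y\<close> makes sure that \<open>g (- y)\<close> is a value of \<open>g\<close> inside its domain \<open>Y\<close>.
  If \<open>Y\<close> is the image of \<open>\<Omega>\<^sup>n\<close> under a map with anti-symmetric components and \<open>n \<ge> 2\<close>, this is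
  automatic (apply a transposition), but for \<open>n = 1\<close> it is not. For \<open>n = 1\<close>, moreover, every
  function is anti-symmetric, so that oddness can fail even if \<open>Y = - Y\<close>: take
  \<open>\<Omega> = {-1, 1} \<subseteq> \<real>\<close>, the identity as the map, and a constant function \<open>f = 1\<close>.
\<close>

definition odd_on :: "'a::group_add set \<Rightarrow> ('a \<Rightarrow> real) \<Rightarrow> bool" where
  "odd_on Y g \<longleftrightarrow> (\<forall>y\<in>Y. - y \<in> Y \<and> g (- y) = - g y)"

end

theory Submission imports Defs begin

text \<open>
  Two tuples with the same image under \<open>\<eta>\<close> have the same image under \<open>f\<close>. If the common value of
  \<open>\<eta>\<close> is \<open>0\<close>, both tuples have a repeated entry, and the transposition of the two equal entries
  forces \<open>f\<close> to vanish on each of them. Otherwise the tuples differ by a permutation \<open>\<sigma>\<close>, and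
  \<open>\<eta> x = (-1)\<^sup>\<sigma> \<eta> x \<noteq> 0\<close> shows that \<open>\<sigma>\<close> is even, so that \<open>f\<close> does not see it. Hence \<open>f\<close> descends
  along \<open>\<eta>\<close> to a function \<open>g\<close> on the image, which is unique because its values are prescribed.

  The power \<open>\<Omega>\<^sup>n\<close> is compact, so the continuous map \<open>\<eta>\<close> onto its image is a quotient map, and \<open>g\<close> is
  continuous along with \<open>f\<close>. If \<open>n \<ge> 2\<close>, then \<open>g\<close> is odd because a transposition of the arguments
  changes the sign of both \<open>\<eta>\<close> and \<open>f\<close>.
\<close>

lemma permute_vec_in_cart_power:
  "x \<in> cart_power \<Omega> \<Longrightarrow> permute_vec \<sigma> x \<in> cart_power \<Omega>"
  by (simp add: cart_power_def permute_vec_def)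

lemma permute_vec_transpose_eq:
  "x $ i = x $ j \<Longrightarrow> permute_vec (Transposition.transpose i j) x = x"
  by (simp add: permute_vec_def vec_eq_iff Transposition.transpose_def)

lemma compact_cart_power:
  fixes \<Omega> :: "'a::heine_borel set"
  assumes "compact \<Omega>"
  shows "compact (cart_power \<Omega> :: ('a ^ 'n::finite) set)"
proof -
  have "closed (cart_power \<Omega> :: ('a ^ 'n) set)"
    unfolding cart_power_def using assms by (intro closed_vector_box) (simp add: compact_imp_closed)
  moreover have "bounded (cart_power \<Omega> :: ('a ^ 'n) set)"
  proof -
    obtain a e where e: "\<forall>y\<in>\<Omega>. dist a y \<le> e"
      using compact_imp_bounded[OF assms] unfolding bounded_def by blast
    have "dist (\<chi> i. a) x \<le> (\<Sum>i\<in>(UNIV :: 'n set). e)" if "x \<in> cart_power \<Omega>" for x :: "'a ^ 'n"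
    proof -
      have "dist (\<chi> i. a) x \<le> (\<Sum>i\<in>UNIV. dist a (x $ i))"
        unfolding dist_vec_def by (simp add: L2_set_le_sum)
      also have "\<dots> \<le> (\<Sum>i\<in>(UNIV :: 'n set). e)"
        using that e by (intro sum_mono) (simp add: cart_power_def)
      finally show ?thesis .
    qed
    then show ?thesis
      unfolding bounded_def by blast
  qed
  ultimately show ?thesis
    by (simp add: compact_eq_bounded_closed)
qed

text \<open>A continuous map from a compact space to a Hausdorff space is a quotient map onto its image.\<close>

lemma continuous_on_image_if_continuous_on_compose:
  fixes h :: "'a::t2_space \<Rightarrow> 'b::t2_space" and g :: "'b \<Rightarrow> 'c::topological_space"
  assumes "compact K" and "continuous_on K h" and "continuous_on K (\<lambda>x. g (h x))"
  shows "continuous_on (h ` K) g"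
proof -
  have "openin (top_of_set (h ` K)) (h ` K \<inter> g -` U)" if "open U" for U
  proof -
    have "openin (top_of_set K) (K \<inter> (\<lambda>x. g (h x)) -` U)"
      using assms(3) that by (rule continuous_openin_preimage_gen)
    moreover have "K \<inter> (\<lambda>x. g (h x)) -` U = K \<inter> h -` (h ` K \<inter> g -` U)"
      by auto
    ultimately show ?thesis
      using Abstract_Topology_2.continuous_imp_quotient_map[OF assms(2) refl assms(1), of "h ` K \<inter> g -` U"] by auto
  qed
  then show ?thesis
    by (simp add: continuous_openin_preimage_eq)
qed

lemma anti_symmetric_onD:
  assumes "anti_symmetric_on \<Omega> f" "\<sigma> permutes UNIV" "x \<in> cart_power \<Omega>"
  shows "f (permute_vec \<sigma> x) = of_int (sign \<sigma>) * f x"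
  using assms by (simp add: anti_symmetric_on_def)

lemma anti_symmetric_on_transpose:
  assumes "anti_symmetric_on \<Omega> f" "x \<in> cart_power \<Omega>" "i \<noteq> j"
  shows "f (permute_vec (Transposition.transpose i j) x) = - f x"
  using anti_symmetric_onD[OF assms(1) permutes_swap_id[of i UNIV j] assms(2)] assms(3)
  by (simp add: sign_swap_id)

lemma anti_symmetric_on_eq_0:
  assumes "anti_symmetric_on \<Omega> f" "x \<in> cart_power \<Omega>" "i \<noteq> j" "x $ i = x $ j"
  shows "f x = 0"
  using anti_symmetric_on_transpose[OF assms(1-3)] permute_vec_transpose_eq[OF assms(4)] by simp

theorem theorem1:
  fixes \<Omega> :: "(real ^ 'd) set"
    and \<eta> :: "real ^ 'd ^ 'n \<Rightarrow> real ^ 'm"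
    and f :: "real ^ 'd ^ 'n \<Rightarrow> real"
  assumes "compact \<Omega>"
    and eta_anti_symmetric: "\<And>k. anti_symmetric_on \<Omega> (\<lambda>x. \<eta> x $ k)"
    and eta_continuous: "\<And>k. continuous_on (cart_power \<Omega>) (\<lambda>x. \<eta> x $ k)"
    and eta_zero_iff: "\<And>x. x \<in> cart_power \<Omega> \<Longrightarrow>
      \<eta> x = 0 \<longleftrightarrow> (\<exists>i j. i \<noteq> j \<and> x $ i = x $ j)"
    and eta_separates: "\<And>x x'. \<lbrakk>x \<in> cart_power \<Omega>; x' \<in> cart_power \<Omega>; \<eta> x = \<eta> x'; \<eta> x \<noteq> 0\<rbrakk> \<Longrightarrow>
      \<exists>\<sigma>. \<sigma> permutes UNIV \<and> x' = permute_vec \<sigma> x"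
    and f_anti_symmetric: "anti_symmetric_on \<Omega> f"
    and f_continuous: "continuous_on (cart_power \<Omega>) f"
  shows "\<exists>!g. g \<in> \<eta> ` cart_power \<Omega> \<rightarrow>\<^sub>E UNIV \<and>
    continuous_on (\<eta> ` cart_power \<Omega>) g \<and>
    (CARD('n) \<ge> 2 \<longrightarrow> odd_on (\<eta> ` cart_power \<Omega>) g) \<and>
    (\<forall>x\<in>cart_power \<Omega>. f x = g (\<eta> x))"
proof -
  let ?K = "cart_power \<Omega> :: (real ^ 'd ^ 'n) set"
  have eta_cont: "continuous_on ?K \<eta>"
    using continuous_on_vec_lambda[of ?K "\<lambda>k x. \<eta> x $ k"] eta_continuous by simp
  have eq: "f x = f x'" if x: "x \<in> ?K" and x': "x' \<in> ?K" and eta: "\<eta> x = \<eta> x'" for x x'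
  proof (cases "\<eta> x = 0")
    case True
    then have "f x = 0" "f x' = 0"
      using eta_zero_iff[OF x] eta_zero_iff[OF x'] eta
        anti_symmetric_on_eq_0[OF f_anti_symmetric x] anti_symmetric_on_eq_0[OF f_anti_symmetric x']
      by auto
    then show ?thesis
      by simp
  next
    case False
    then obtain \<sigma> where \<sigma>: "\<sigma> permutes UNIV" and x'_eq: "x' = permute_vec \<sigma> x"
      using eta_separates[OF x x' eta] by blast
    obtain k where k: "\<eta> x $ k \<noteq> 0"
      using False by (auto simp: vec_eq_iff)
    have "\<eta> x $ k = of_int (sign \<sigma>) * \<eta> x $ k"
      using anti_symmetric_onD[OF eta_anti_symmetric \<sigma> x, of k] eta x'_eq by simp
    then have "sign \<sigma> = 1"
      using k by (cases \<sigma> rule: sign_cases) auto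
    then show ?thesis
      using anti_symmetric_onD[OF f_anti_symmetric \<sigma> x] x'_eq by simp
  qed
  define g where "g = restrict (\<lambda>y. f (inv_into ?K \<eta> y)) (\<eta> ` ?K)"
  have g: "f x = g (\<eta> x)" if "x \<in> ?K" for x
    using that by (auto simp: g_def f_inv_into_f inv_into_into intro!: eq)
  have "continuous_on ?K (\<lambda>x. g (\<eta> x))"
    using f_continuous g by (simp cong: continuous_on_cong)
  then have g_cont: "continuous_on (\<eta> ` ?K) g"
    by (rule continuous_on_image_if_continuous_on_compose[OF compact_cart_power[OF assms(1)] eta_cont])
  have g_odd: "odd_on (\<eta> ` ?K) g" if "CARD('n) \<ge> 2"
  proof -
    have "\<not> CARD('n) \<le> Suc 0"
      using that by simp
    then obtain i j :: 'n where ij: "i \<noteq> j"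
      using card_le_Suc0_iff_eq[of "UNIV :: 'n set"] by auto
    have "- \<eta> x \<in> \<eta> ` ?K \<and> g (- \<eta> x) = - g (\<eta> x)" if x: "x \<in> ?K" for x
    proof -
      let ?x' = "permute_vec (Transposition.transpose i j) x"
      have x': "?x' \<in> ?K"
        using x by (rule permute_vec_in_cart_power)
      have neg: "\<eta> ?x' = - \<eta> x"
        using anti_symmetric_on_transpose[OF eta_anti_symmetric x ij] by (simp add: vec_eq_iff)
      have "g (- \<eta> x) = - g (\<eta> x)"
        using anti_symmetric_on_transpose[OF f_anti_symmetric x ij] g[OF x] g[OF x'] neg by simp
      then show ?thesis
        using x' neg by (metis imageI)
    qed
    then show ?thesis
      by (auto simp: odd_on_def)
  qed
  show ?thesis
  proof (rule ex1I[of _ g])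
    show "g \<in> \<eta> ` ?K \<rightarrow>\<^sub>E UNIV \<and> continuous_on (\<eta> ` ?K) g \<and>
        (CARD('n) \<ge> 2 \<longrightarrow> odd_on (\<eta> ` ?K) g) \<and> (\<forall>x\<in>?K. f x = g (\<eta> x))"
      using g_cont g_odd g by (auto simp: g_def)
  next
    fix g'
    assume g': "g' \<in> \<eta> ` ?K \<rightarrow>\<^sub>E UNIV \<and> continuous_on (\<eta> ` ?K) g' \<and>
        (CARD('n) \<ge> 2 \<longrightarrow> odd_on (\<eta> ` ?K) g') \<and> (\<forall>x\<in>?K. f x = g' (\<eta> x))"
    have "g \<in> \<eta> ` ?K \<rightarrow>\<^sub>E UNIV"
      by (simp add: g_def)
    moreover have "g' y = g y" if "y \<in> \<eta> ` ?K" for y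
      using that g' g by force
    ultimately show "g' = g"
      using g' by (intro PiE_ext[of g' "\<eta> ` ?K" "\<lambda>_. UNIV"]) auto
  qed
qed

end
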